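(* Fix an integer $h>0$. Then, as $k \to \infty$, \[ E(h,k) \sim (h-1)\,\frac{\log k}{\log\log k}. \]
   Context: Let $\mathbb{N}$ denote the set of positive integers. For $A\subseteq \mathbb{N}$ and a positive integer $h$, $hA$ is the set of all sums of exactly $h$ not necessarily distinct elements of $A$. We write $hA\sim\mathbb{N}$ if all but finitely many positive integers lie in $hA$. A set $A\subseteq\mathbb{N}$ is a basis of order $h$ if $hA\sim\mathbb{N}$ but $(h-1)A\not\sim\mathbb{N}$; $A$ is a basis (of some order) if it is a basis of order $h$ for some $h$. If $A$ is a basis, a finite subset $E\subseteq A$ is an essential subset of $A$ if $A\setminus E$ is not a basis of any order, and $E$ is minimal (with respect to inclusion) with this property. $E(h,k)$ denotes the maximum possible number of essential subsets of size $k$ in a basis of order $h$ (this maximum is finite). The notation $F(k)\sim G(k)$ means $F(k)/G(k)\to 1$ as $k\to\infty$. *)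

theory Defs
  imports Complex_Main "HOL-Library.Landau_Symbols"
begin

definition pos_nat_set :: "nat set \<Rightarrow> bool" where
  "pos_nat_set A \<longleftrightarrow> 0 \<notin> A"

definition sumset :: "nat \<Rightarrow> nat set \<Rightarrow> nat set" where
  "sumset h A = {x. \<exists>f. (\<forall>i<h. f i \<in> A) \<and> x = (\<Sum>i<h. f i)}"

definition cofin_pos :: "nat set \<Rightarrow> bool" where
  "cofin_pos S \<longleftrightarrow> finite ({0<..} - S)"

definition basis_of_order :: "nat set \<Rightarrow> nat \<Rightarrow> bool" where
  "basis_of_order A h \<longleftrightarrow> pos_nat_set A \<and> h > 0 \<and>
     cofin_pos (sumset h A) \<and> \<not> cofin_pos (sumset (h - 1) A)"

definition is_basis :: "nat set \<Rightarrow> bool" where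
  "is_basis A \<longleftrightarrow> (\<exists>h. basis_of_order A h)"

definition essential_subset :: "nat set \<Rightarrow> nat set \<Rightarrow> bool" where
  "essential_subset A E \<longleftrightarrow> is_basis A \<and> finite E \<and> E \<subseteq> A \<and> \<not> is_basis (A - E) \<and>
     (\<forall>E'. E' \<subset> E \<longrightarrow> is_basis (A - E'))"

definition E_max :: "nat \<Rightarrow> nat \<Rightarrow> nat" where
  "E_max h k = Sup {card {E. essential_subset A E \<and> card E = k} | A. basis_of_order A h}"

end

(*
  An essential subset E of a basis A is the set of elements of A outside one residue class modulo
  some prime p, and distinct essential subsets belong to distinct primes. Let P be the product of
  the n primes belonging to n essential subsets of size k. Off a set F of at most n k elements, A
  lies in one class modulo P, and a large sum of h elements of A uses one of these; hence h - 1
  summands from n k + 1 classes reach all P >= (n + 1)! residues, which gives the upper bound.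
  Conversely, take h - 1 blocks of primes, each with product at most k. The multiples of P,
  together with representatives of the nonzero classes modulo P supported on a single block, form
  a basis of order h, and padding makes the set of elements prime to each chosen p of size exactly
  k. Chebyshev's lower bound supplies enough primes of size O(log k) for blocks of
  log k / log log k primes.
*)
theory Submission
  imports Defs "HOL-Number_Theory.Cong" "HOL-Real_Asymp.Real_Asymp"
begin

subsection \<open>Sumsets and the residue criterion for bases\<close>

lemma sumset_0 [simp]: "sumset 0 A = {0}"
  by (auto simp: sumset_def)

lemma sumset_Suc: "sumset (Suc m) A = {x + a | x a. x \<in> sumset m A \<and> a \<in> A}"
proof (intro equalityI subsetI)
  fix z assume "z \<in> sumset (Suc m) A"
  then obtain f where f: "\<forall>i<Suc m. f i \<in> A" "z = (\<Sum>i<Suc m. f i)"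
    unfolding sumset_def by blast
  have "(\<Sum>i<m. f i) \<in> sumset m A"
    unfolding sumset_def mem_Collect_eq by (rule exI[of _ f]) (use f in simp)
  moreover have "z = (\<Sum>i<m. f i) + f m" "f m \<in> A"
    using f by simp_all
  ultimately show "z \<in> {x + a | x a. x \<in> sumset m A \<and> a \<in> A}"
    by blast
next
  fix z assume "z \<in> {x + a | x a. x \<in> sumset m A \<and> a \<in> A}"
  then obtain x a where "z = x + a" "x \<in> sumset m A" and a: "a \<in> A"
    by blast
  then obtain f where f: "\<forall>i<m. f i \<in> A" "z = (\<Sum>i<m. f i) + a"
    unfolding sumset_def by blast
  have "(\<Sum>i<m. (f(m := a)) i) = (\<Sum>i<m. f i)"
    by (intro sum.cong) auto
  with f a show "z \<in> sumset (Suc m) A"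
    unfolding sumset_def mem_Collect_eq by (intro exI[of _ "f(m := a)"]) (simp add: less_Suc_eq)
qed

lemma sumset_add:
  assumes "x \<in> sumset m A" "y \<in> sumset n A"
  shows "x + y \<in> sumset (m + n) A"
  using assms(2)
proof (induction n arbitrary: y)
  case (Suc n)
  then show ?case
    by (simp add: sumset_Suc) (metis add.assoc)
qed (use assms(1) in auto)

lemma sumset_mult: "x \<in> sumset m A \<Longrightarrow> n * x \<in> sumset (n * m) A"
  by (induction n) (auto intro: sumset_add)

lemma card_sumset_le:
  assumes "finite C"
  shows "finite (sumset m C) \<and> card (sumset m C) \<le> card C ^ m"
proof (induction m)
  case (Suc m)
  have eq: "sumset (Suc m) C = (\<lambda>(x, a). x + a) ` (sumset m C \<times> C)"
    by (auto simp: sumset_Suc)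
  have "card (sumset (Suc m) C) \<le> card (sumset m C \<times> C)"
    unfolding eq using Suc assms by (intro card_image_le) auto
  also have "\<dots> \<le> card C ^ m * card C"
    using Suc by (simp add: card_cartesian_product)
  finally show ?case
    using Suc assms eq by (simp add: mult.commute)
qed auto

text \<open>If all summands were at most \<open>M\<close>, the sum would be at most
  \<open>Suc m * M\<close>. This peels off a summand outside a finite exceptional set.\<close>

lemma sumset_large_summand:
  assumes "x \<in> sumset (Suc m) A" "x > Suc m * M"
  shows "\<exists>a\<in>A. \<exists>y\<in>sumset m A. a > M \<and> x = a + y"
  using assms
proof (induction m arbitrary: x)
  case 0
  then show ?case by (auto simp: sumset_Suc)
next
  case (Suc m)
  from Suc.prems(1) obtain y a where y: "x = y + a" "y \<in> sumset (Suc m) A" "a \<in> A"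
    by (auto simp: sumset_Suc[of "Suc m"])
  show ?case
  proof (cases "a > M")
    case True
    then show ?thesis using y by force
  next
    case False
    then have "y > Suc m * M" using y Suc.prems(2) by simp
    from Suc.IH[OF y(2) this] obtain a' z where "a' \<in> A" "z \<in> sumset m A" "a' > M" "y = a' + z"
      by auto
    then show ?thesis using y
      by (intro bexI[of _ a'] bexI[of _ "z + a"]) (auto simp: sumset_Suc)
  qed
qed

text \<open>Each replaced summand costs an error of at most \<open>c\<close> in either direction,
  and the number of summands is unchanged.\<close>

lemma sumset_approx:
  assumes "\<And>a. a \<in> A \<Longrightarrow> \<exists>b\<in>B. b \<le> a + c \<and> a \<le> b + c"
  assumes "x \<in> sumset m A"
  shows "\<exists>y\<in>sumset m B. y \<le> x + m * c \<and> x \<le> y + m * c"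
  using assms(2)
proof (induction m arbitrary: x)
  case (Suc m)
  then obtain y a where y: "x = y + a" "y \<in> sumset m A" "a \<in> A"
    by (auto simp: sumset_Suc)
  from Suc.IH[OF y(2)] obtain z where z: "z \<in> sumset m B" "z \<le> y + m * c" "y \<le> z + m * c"
    by auto
  from assms(1)[OF y(3)] obtain b where b: "b \<in> B" "b \<le> a + c" "a \<le> b + c"
    by auto
  show ?case
    by (rule bexI[of _ "z + b"]) (use y z b in \<open>auto simp: sumset_Suc\<close>)
qed auto

lemma sumset_cong:
  assumes "\<And>a. a \<in> A \<Longrightarrow> \<exists>b\<in>B. [a = b] (mod P)"
  assumes "x \<in> sumset m A"
  shows "\<exists>y\<in>sumset m B. [x = y] (mod P)"
  using assms(2)
proof (induction m arbitrary: x)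
  case (Suc m)
  then obtain y a where y: "x = y + a" "y \<in> sumset m A" "a \<in> A"
    by (auto simp: sumset_Suc)
  from Suc.IH[OF y(2)] obtain z where z: "z \<in> sumset m B" "[y = z] (mod P)"
    by auto
  from assms(1)[OF y(3)] obtain b where b: "b \<in> B" "[a = b] (mod P)"
    by auto
  show ?case
    by (rule bexI[of _ "z + b"]) (use y z b in \<open>auto simp: sumset_Suc intro: cong_add\<close>)
qed auto

lemma sumset_finite: "finite A \<Longrightarrow> finite (sumset m A)"
  using card_sumset_le by blast

section \<open>Cofinite sets and bases\<close>

lemma cofin_pos_iff: "cofin_pos S \<longleftrightarrow> (\<exists>N. \<forall>n>N. n \<in> S)"
proof
  assume "cofin_pos S"
  then obtain N where N: "\<forall>n\<in>{0<..} - S. n \<le> N"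
    unfolding cofin_pos_def finite_nat_set_iff_bounded_le by blast
  have "\<forall>n>N. n \<in> S"
  proof (intro allI impI)
    fix n assume "n > N"
    then have "n \<notin> {0<..} - S" using N leD by blast
    then show "n \<in> S" using \<open>n > N\<close> by simp
  qed
  then show "\<exists>N. \<forall>n>N. n \<in> S" by blast
next
  assume "\<exists>N. \<forall>n>N. n \<in> S"
  then obtain N where N: "\<forall>n>N. n \<in> S" by blast
  have "{0<..} - S \<subseteq> {..N}" using N by (auto simp: not_less[symmetric])
  then show "cofin_pos S"
    unfolding cofin_pos_def using finite_subset by blast
qed

lemma not_cofin_pos_finite: "finite S \<Longrightarrow> \<not> cofin_pos S"
  unfolding cofin_pos_def using Diff_infinite_finite[of S "{0<..}"] infinite_Ioi[of 0] by blast

text \<open>The least \<open>h\<close> with a cofinite sumset is an exact order; it is positive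
  because \<open>sumset 0 A\<close> is finite.\<close>

lemma is_basis_iff: "is_basis A \<longleftrightarrow> 0 \<notin> A \<and> (\<exists>h. cofin_pos (sumset h A))"
proof
  assume "0 \<notin> A \<and> (\<exists>h. cofin_pos (sumset h A))"
  then have *: "0 \<notin> A" "\<exists>h. cofin_pos (sumset h A)" by auto
  define h where "h = (LEAST h. cofin_pos (sumset h A))"
  have h: "cofin_pos (sumset h A)"
    unfolding h_def using *(2) by (rule LeastI_ex)
  have "h > 0"
    using h not_cofin_pos_finite[of "{0}"] by (cases h) auto
  moreover have "\<not> cofin_pos (sumset (h - 1) A)"
    using \<open>h > 0\<close> not_less_Least[of "h - 1" "\<lambda>h. cofin_pos (sumset h A)"] by (simp add: h_def)
  ultimately show "is_basis A"
    using h * unfolding is_basis_def basis_of_order_def pos_nat_set_def by blast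
qed (auto simp: is_basis_def basis_of_order_def pos_nat_set_def)

lemma basis_infinite: "is_basis A \<Longrightarrow> infinite A"
  unfolding is_basis_iff using sumset_finite not_cofin_pos_finite by blast

text \<open>Otherwise all sums of \<open>h\<close> elements would be congruent to
  \<open>h * r\<close>, but two consecutive large integers are not congruent modulo
  \<open>p\<close>.\<close>

lemma basis_not_single_class:
  assumes "is_basis A" "p \<ge> 2"
  shows "\<exists>a\<in>A. [a \<noteq> r] (mod p)"
proof (rule ccontr)
  assume "\<not> ?thesis"
  then have *: "\<exists>b\<in>{r}. [a = b] (mod p)" if "a \<in> A" for a
    using that by simp
  obtain h where "cofin_pos (sumset h A)"
    using assms(1) by (auto simp: is_basis_iff)
  then obtain N where N: "\<And>n. n > N \<Longrightarrow> n \<in> sumset h A"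
    by (auto simp: cofin_pos_iff)
  have single: "sumset h {r} = {h * r}"
    by (induction h) (simp_all add: sumset_Suc add.commute)
  have c: "[n = h * r] (mod p)" if "n > N" for n
  proof -
    have "n \<in> sumset h A" using N that by blast
    from sumset_cong[OF * this] show ?thesis by (simp add: single)
  qed
  have "[N + 2 = h * r] (mod p)" "[N + 1 = h * r] (mod p)"
    by (rule c, simp)+
  then have "[N + 2 = N + 1] (mod p)"
    using cong_trans cong_sym by blast
  then have "p dvd (N + 2) - (N + 1)"
    using cong_altdef_nat[of "N + 1" "N + 2" p] by linarith
  then show False using assms(2) by simp
qed

section \<open>Removing a finite set from a basis\<close>

text \<open>The differences of two sums with equally many terms form a subgroup of the integers; if
  it were proper, \<^term>\<open>B\<close> would lie in one class modulo a prime.\<close>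
lemma consecutive_in_sumset:
  assumes "\<And>p r. prime p \<Longrightarrow> \<exists>b\<in>B. [b \<noteq> r] (mod p)"
  shows "\<exists>M x. x \<in> sumset M B \<and> x + 1 \<in> sumset M B"
proof -
  define G where "G = {int u - int v | u v. \<exists>M. u \<in> sumset M B \<and> v \<in> sumset M B}"
  have G0: "0 \<in> G" unfolding G_def by (force intro!: exI[of _ 0])
  have Gm: "- x \<in> G" if "x \<in> G" for x using that unfolding G_def by force
  have Ga: "x + y \<in> G" if "x \<in> G" "y \<in> G" for x y
  proof -
    obtain u v M where 1: "x = int u - int v" "u \<in> sumset M B" "v \<in> sumset M B"
      using \<open>x \<in> G\<close> unfolding G_def by blast
    obtain u' v' M' where 2: "y = int u' - int v'" "u' \<in> sumset M' B" "v' \<in> sumset M' B"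
      using \<open>y \<in> G\<close> unfolding G_def by blast
    have "x + y = int (u + u') - int (v + v')" using 1 2 by simp
    moreover have "u + u' \<in> sumset (M + M') B" "v + v' \<in> sumset (M + M') B"
      using 1 2 by (auto intro: sumset_add)
    ultimately show ?thesis unfolding G_def by blast
  qed
  have Gn: "int n * x \<in> G" if "x \<in> G" for x n
    by (induction n) (auto simp: G0 distrib_right intro: Ga that)
  have Gz: "n * x \<in> G" if "x \<in> G" for x n
  proof (cases n)
    case (nonneg m) then show ?thesis using Gn that by auto
  next
    case (neg m)
    then have "n * x = - (int (Suc m) * x)" by (simp only: minus_mult_left)
    then show ?thesis using Gm[OF Gn[OF that, of "Suc m"]] by simp
  qed
  have B1: "sumset 1 B = B" by (auto simp: sumset_Suc)
  have diff: "int b - int b' \<in> G" if "b \<in> B" "b' \<in> B" for b b'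
    unfolding G_def using that B1 by blast
  obtain b0 where b0: "b0 \<in> B" using assms[of 2 0] by auto
  \<comment> \<open>An element incongruent to \<open>b0\<close> modulo 2 differs from
    \<open>b0\<close>, so \<open>G\<close> contains a nonzero integer.\<close>
  obtain b1 where b1: "b1 \<in> B" "b1 \<noteq> b0" using assms[of 2 b0] two_is_prime_nat cong_refl by metis
  have "\<bar>int b1 - int b0\<bar> \<in> G" using diff[OF b1(1) b0] diff[OF b0 b1(1)] by (simp add: abs_if)
  then have ex: "\<exists>n. n > 0 \<and> int n \<in> G"
    using b1(2) by (intro exI[of _ "nat \<bar>int b1 - int b0\<bar>"]) auto
  define g where "g = (LEAST n. n > 0 \<and> int n \<in> G)"
  have g: "g > 0" "int g \<in> G" using LeastI_ex[OF ex] by (auto simp: g_def)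
  have dvd: "int g dvd x" if "x \<in> G" for x
  proof -
    have "x mod int g = x + (- (x div int g)) * int g"
      using div_mult_mod_eq[of x "int g"] by (simp add: algebra_simps)
    also have "\<dots> \<in> G" using that g Gz Ga by blast
    finally have "int (nat (x mod int g)) \<in> G" using g by simp
    moreover have "nat (x mod int g) < g" using g
      by (simp add: nat_less_iff)
    ultimately have "nat (x mod int g) = 0"
      using not_less_Least[of "nat (x mod int g)" "\<lambda>n. n > 0 \<and> int n \<in> G"]
      unfolding g_def by auto
    moreover have "x mod int g \<ge> 0" using g by simp
    ultimately show ?thesis by (simp add: dvd_eq_mod_eq_0)
  qed
  have "g = 1"
  proof (rule ccontr)
    assume "g \<noteq> 1"
    then obtain p where p: "prime p" "p dvd g" using prime_factor_nat by blast
    have "[b = b0] (mod p)" if "b \<in> B" for b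
    proof -
      have "int p dvd int b - int b0"
        using p dvd[OF diff[OF that b0]] by (meson dvd_trans int_dvd_int_iff)
      then show ?thesis by (simp add: cong_iff_dvd_diff cong_int_iff[symmetric])
    qed
    then show False using assms[OF p(1), of b0] by auto
  qed
  then obtain u v M where "1 = int u - int v" "u \<in> sumset M B" "v \<in> sumset M B"
    using g unfolding G_def by auto
  moreover from this have "u = v + 1" by simp
  ultimately show ?thesis by blast
qed

text \<open>Mixing \<open>L - j\<close> copies of \<open>x\<close> with \<open>j\<close> copies of
  \<open>x + 1\<close> keeps the number of summands at \<open>L * M\<close>, so sums of one fixed
  length fill an interval.\<close>

lemma sumset_interval:
  assumes "x \<in> sumset M B" "x + 1 \<in> sumset M B" "j \<le> L"
  shows "L * x + j \<in> sumset (L * M) B"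
proof -
  have "(L - j) * x + j * (x + 1) \<in> sumset ((L - j) * M + j * M) B"
    using assms by (intro sumset_add sumset_mult)
  moreover have "(L - j) * M + j * M = L * M" "(L - j) * x + j * x = L * x"
    using assms(3) by (simp_all flip: add_mult_distrib)
  ultimately show ?thesis by (simp add: algebra_simps)
qed

text \<open>Replacing deleted summands by a fixed survivor changes a sum by a bounded amount, and an
  interval of sums of one fixed length corrects the error. With
  \<open>basis_not_single_class\<close>, a residue class modulo a prime is thus the only obstruction
  to removing a finite set.\<close>

lemma basis_remove_finite:
  assumes A: "is_basis A" and E: "finite E"
    and cls: "\<And>p r. prime p \<Longrightarrow> \<exists>b\<in>A - E. [b \<noteq> r] (mod p)"
  shows "is_basis (A - E)"
proof -
  let ?B = "A - E"
  obtain h N where N: "\<forall>n>N. n \<in> sumset h A"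
    using A unfolding is_basis_iff cofin_pos_iff by blast
  obtain M x where x: "x \<in> sumset M ?B" "x + 1 \<in> sumset M ?B"
    using consecutive_in_sumset[OF cls] by blast
  obtain b0 where b0: "b0 \<in> ?B" using cls[of 2 0] by auto
  obtain c where c: "\<forall>e\<in>insert b0 E. e \<le> c"
    using E by (meson finite_insert finite_nat_set_iff_bounded_le)
  have ap: "\<exists>b\<in>?B. b \<le> a + c \<and> a \<le> b + c" if "a \<in> A" for a
  proof (cases "a \<in> E")
    case True
    then show ?thesis using b0 c by (intro bexI[of _ b0]) auto
  next
    case False
    then show ?thesis using that by (intro bexI[of _ a]) auto
  qed
  \<comment> \<open>The approximating sum is off by at most \<open>h * c\<close> in either
    direction; after a shift by \<open>h * c\<close> the correction lies between 0 and
    \<open>2 * h * c\<close>.\<close>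
  define L where "L = 2 * h * c"
  have "n \<in> sumset (h + L * M) ?B" if n: "n > N + h * c + L * x" for n
  proof -
    define n' where "n' = n - h * c - L * x"
    have n': "n = n' + h * c + L * x" "n' > N" using n by (auto simp: n'_def)
    then obtain y where y: "y \<in> sumset h ?B" "y \<le> n' + h * c" "n' \<le> y + h * c"
      using sumset_approx[OF ap, where x = n' and m = h] N by blast
    have "y + (L * x + (n' + h * c - y)) \<in> sumset (h + L * M) ?B"
      by (intro sumset_add y sumset_interval x) (use y in \<open>auto simp: L_def\<close>)
    also have "y + (L * x + (n' + h * c - y)) = n" using y n' by simp
    finally show ?thesis .
  qed
  then show ?thesis
    using A unfolding is_basis_iff cofin_pos_iff by blast
qed

text \<open>The obstruction is a class modulo a prime containing \<open>A - E\<close>. Removing only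
  the elements outside that class already destroys the basis, so minimality forces equality.\<close>

lemma essential_subset_eq:
  assumes "essential_subset A E"
  shows "\<exists>p r. prime p \<and> E = {a \<in> A. [a \<noteq> r] (mod p)}"
proof -
  have E: "is_basis A" "finite E" "E \<subseteq> A" "\<not> is_basis (A - E)"
     "\<And>E'. E' \<subset> E \<Longrightarrow> is_basis (A - E')"
    using assms by (auto simp: essential_subset_def)
  obtain p r where p: "prime p" "\<forall>b\<in>A - E. [b = r] (mod p)"
    using basis_remove_finite[OF E(1,2)] E(4) by blast
  define E' where "E' = {a \<in> A. [a \<noteq> r] (mod p)}"
  have "E' \<subseteq> E" using p by (auto simp: E'_def)
  moreover have "\<not> is_basis (A - E')"
    using basis_not_single_class[of "A - E'" p r] prime_ge_2_nat[OF p(1)]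
    by (auto simp: E'_def)
  ultimately have "E' = E" using E(5) by blast
  then show ?thesis using p(1) unfolding E'_def by blast
qed

subsection \<open>Upper bound\<close>

text \<open>The largest of \<open>n\<close> distinct integers from 2 on is at least
  \<open>n + 1\<close>; induction on the rest gives the factorial.\<close>

lemma fact_card_le_prod:
  fixes S :: "nat set"
  assumes "finite S" "\<And>p. p \<in> S \<Longrightarrow> p \<ge> 2"
  shows "fact (card S + 1) \<le> \<Prod>S"
  using assms
proof (induction "card S" arbitrary: S)
  case 0
  then show ?case by simp
next
  case (Suc n)
  define q where "q = Max S"
  have ne: "S \<noteq> {}" using Suc.hyps(2) by auto
  then have q: "q \<in> S" using Suc.prems by (simp add: q_def)
  have card: "card (S - {q}) = n" using q Suc.hyps(2) Suc.prems(1) by simp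
  have "S \<subseteq> {2..q}"
    using Suc.prems by (auto simp: q_def)
  then have "card S \<le> card {2..q}" by (intro card_mono) auto
  then have "n + 2 \<le> q" using Suc.hyps(2) by simp
  moreover have "fact (n + 1) \<le> \<Prod>(S - {q})"
    using Suc.hyps(1)[of "S - {q}"] card Suc.prems by auto
  ultimately have "fact (n + 2) \<le> q * \<Prod>(S - {q})"
    using mult_le_mono[of "n + 2" q "fact (n + 1)"] by simp
  also have "\<dots> = \<Prod>S" using q Suc.prems(1) by (simp add: prod.remove)
  finally show ?case by (simp add: Suc.hyps(2)[symmetric])
qed

lemma cong_prod_distinct_primes:
  fixes S :: "nat set"
  assumes "finite S" "\<And>p. p \<in> S \<Longrightarrow> prime p" "\<And>p. p \<in> S \<Longrightarrow> [x = y] (mod p)"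
  shows "[x = y] (mod \<Prod>S)"
  using assms
proof (induction S rule: finite_induct)
  case (insert q S)
  have "coprime q (\<Prod>S)"
    using insert by (intro prod_coprime_right) (auto intro: primes_coprime)
  then show ?case using insert by (simp add: coprime_cong_mult_nat)
qed auto

text \<open>Off the union \<^term>\<open>F\<close> of the essential sets, \<^term>\<open>A\<close> lies in one class modulo the product of
  the associated primes. A large element of \<^term>\<open>sumset h A\<close> has a summand outside \<^term>\<open>F\<close>, so
  \<open>h - 1\<close> summands from at most \<open>n * k + 1\<close> classes reach all residues.\<close>
lemma essential_family_bound:
  assumes A: "basis_of_order A h" and fin: "finite \<E>"
    and \<E>: "\<And>E. E \<in> \<E> \<Longrightarrow> essential_subset A E \<and> card E = k"
  shows "fact (card \<E> + 1) \<le> (card \<E> * k + 1) ^ (h - 1)"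
proof -
  have basis: "is_basis A" and h: "h > 0" and cof: "cofin_pos (sumset h A)"
    using A by (auto simp: is_basis_def basis_of_order_def)
  have "\<forall>E\<in>\<E>. \<exists>p r. prime p \<and> E = {a \<in> A. [a \<noteq> r] (mod p)}"
    using \<E> essential_subset_eq by blast
  then obtain p r where "\<forall>E\<in>\<E>. prime (p E) \<and> E = {a \<in> A. [a \<noteq> r E] (mod p E)}"
    by metis
  then have prime: "\<And>E. E \<in> \<E> \<Longrightarrow> prime (p E)"
    and mem: "\<And>E a. E \<in> \<E> \<Longrightarrow> a \<in> E \<longleftrightarrow> a \<in> A \<and> [a \<noteq> r E] (mod p E)"
    by blast+
  define F where "F = \<Union>\<E>"
  have finE: "finite E" if "E \<in> \<E>" for E
    using \<E>[OF that] by (simp add: essential_subset_def)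
  have finF: "finite F" using fin finE by (auto simp: F_def)
  have "infinite (A - F)" using basis_infinite[OF basis] finF by simp
  then obtain a0 where a0: "a0 \<in> A" "a0 \<notin> F" by (metis Diff_iff ex_in_conv finite.emptyI)
  have a0r: "[a0 = r E] (mod p E)" if "E \<in> \<E>" for E
    using that a0 mem[OF that, of a0] unfolding F_def by blast
  have aF: "[a = a0] (mod p E)" if "E \<in> \<E>" "a \<in> A" "a \<notin> E" for E a
    using mem[OF that(1), of a] that a0r[OF that(1)] cong_trans cong_sym by blast
  have mem_a0: "a \<in> E \<longleftrightarrow> a \<in> A \<and> [a \<noteq> a0] (mod p E)" if "E \<in> \<E>" for E a
    using mem[OF that, of a] aF[OF that, of a] a0r[OF that] cong_trans by blast
  \<comment> \<open>Once the class is that of \<open>a0\<close>, the prime alone determines the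
    essential set.\<close>
  have inj: "inj_on p \<E>"
  proof (rule inj_onI)
    fix E E' assume "E \<in> \<E>" "E' \<in> \<E>" "p E = p E'"
    then show "E = E'" using mem_a0 by (intro set_eqI) presburger
  qed
  define S where "S = p ` \<E>"
  have S: "finite S" "card S = card \<E>" "\<And>q. q \<in> S \<Longrightarrow> prime q"
    using fin inj prime by (auto simp: S_def card_image)
  define P where "P = \<Prod>S"
  have P0: "P > 0" unfolding P_def using S(3) prime_gt_0_nat by (intro prod_pos) blast
  have cls: "[a = a0] (mod P)" if "a \<in> A" "a \<notin> F" for a
    unfolding P_def using S that aF
    by (intro cong_prod_distinct_primes) (auto simp: S_def F_def)
  define C where "C = insert a0 F"
  have red: "\<exists>b\<in>C. [a = b] (mod P)" if "a \<in> A" for a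
    using cls[OF that] cong_refl[of a P] unfolding C_def by blast
  have "card F \<le> (\<Sum>E\<in>\<E>. card E)"
    unfolding F_def by (rule card_Union_le_sum_card)
  also have "\<dots> = card \<E> * k" using \<E> by simp
  finally have "card F \<le> card \<E> * k" .
  then have cardC: "card C \<le> card \<E> * k + 1"
    using finF a0 by (simp add: C_def)
  have finC: "finite C" using finF by (simp add: C_def)
  obtain N where N: "\<And>n. n > N \<Longrightarrow> n \<in> sumset h A"
    using cof unfolding cofin_pos_iff by blast
  obtain M where M: "\<And>a. a \<in> F \<Longrightarrow> a \<le> M"
    using finF by (meson finite_nat_set_iff_bounded_le)
  have sub: "{..<P} \<subseteq> (\<lambda>z. (a0 + z) mod P) ` sumset (h - 1) C"
  proof
    fix c assume c: "c \<in> {..<P}"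
    \<comment> \<open>\<open>n\<close> has residue \<open>c\<close> and is so large that some
      summand exceeds \<open>M\<close>, hence lies outside \<open>F\<close>.\<close>
    define n where "n = c + P * (N + h * M + 1)"
    have "1 * (N + h * M + 1) \<le> P * (N + h * M + 1)"
      using P0 by (intro mult_le_mono1) simp
    then have "N + h * M + 1 \<le> n" unfolding n_def mult_1 by (rule trans_le_add2)
    then have n: "n > N" "n > h * M" by simp_all
    have "n \<in> sumset (Suc (h - 1)) A" using N[OF n(1)] h by simp
    moreover have "n > Suc (h - 1) * M" using n(2) h by simp
    ultimately obtain a y where ay: "a \<in> A" "y \<in> sumset (h - 1) A" "a > M" "n = a + y"
      using sumset_large_summand by blast
    have a: "[a = a0] (mod P)" using cls[OF ay(1)] M[of a] ay(3) by (meson leD)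
    obtain z where z: "z \<in> sumset (h - 1) C" "[y = z] (mod P)"
      using sumset_cong[OF red ay(2)] by blast
    have "n mod P = (a0 + z) mod P"
      using cong_add[OF a z(2)] unfolding ay(4) unique_euclidean_semiring_class.cong_def .
    moreover have "n mod P = c" using c unfolding n_def mod_mult_self2 by simp
    ultimately have "(a0 + z) mod P = c" by (rule subst)
    then show "c \<in> (\<lambda>z. (a0 + z) mod P) ` sumset (h - 1) C"
      using z(1) by blast
  qed
  have "fact (card \<E> + 1) \<le> P"
    using fact_card_le_prod[OF S(1) prime_ge_2_nat[OF S(3)]] S(2) by (simp add: P_def)
  also have "P = card {..<P}" by simp
  also have "\<dots> \<le> card (sumset (h - 1) C)"
    by (rule surj_card_le[OF _ sub]) (simp add: sumset_finite finC)
  also have "\<dots> \<le> card C ^ (h - 1)" using card_sumset_le[OF finC] by simp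
  also have "\<dots> \<le> (card \<E> * k + 1) ^ (h - 1)" by (rule power_mono[OF cardC]) simp
  finally show ?thesis .
qed

text \<open>A family that is infinite or has at least \<open>n\<close> members contains one with
  exactly \<open>n\<close>, so a single \<open>n\<close> violating
  \<open>essential_family_bound\<close> caps all families.\<close>

lemma card_essential_subsets_less:
  assumes A: "basis_of_order A h" and n: "(n * k + 1) ^ (h - 1) < fact (n + 1)"
  shows "finite {E. essential_subset A E \<and> card E = k}"
    and "card {E. essential_subset A E \<and> card E = k} < n"
proof -
  let ?T = "{E. essential_subset A E \<and> card E = k}"
  have no: "card \<E> \<noteq> n" if "\<E> \<subseteq> ?T" "finite \<E>" for \<E>
  proof
    assume "card \<E> = n"
    moreover have "fact (card \<E> + 1) \<le> (card \<E> * k + 1) ^ (h - 1)"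
      using that by (intro essential_family_bound[OF A]) auto
    ultimately show False using n by (metis not_less)
  qed
  show "finite ?T"
  proof (rule ccontr)
    assume "infinite ?T"
    then obtain \<F> where "finite \<F>" "card \<F> = n" "\<F> \<subseteq> ?T"
      using infinite_arbitrarily_large by blast
    then show False using no by blast
  qed
  show "card ?T < n"
  proof (rule ccontr)
    assume "\<not> card ?T < n"
    then have "n \<le> card ?T" by (rule leI)
    then obtain \<F> where "\<F> \<subseteq> ?T" "card \<F> = n" "finite \<F>"
      by (rule obtain_subset_with_card_n)
    then show False using no by blast
  qed
qed

section \<open>Bounds for \<open>E_max\<close>\<close>

lemma E_max_less:
  assumes "n > 0" "(n * k + 1) ^ (h - 1) < fact (n + 1)"
  shows "E_max h k < n"
proof -
  let ?X = "{card {E. essential_subset A E \<and> card E = k} | A. basis_of_order A h}"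
  have X: "x \<le> n - 1" if "x \<in> ?X" for x
    using that card_essential_subsets_less(2)[OF _ assms(2)] by fastforce
  show ?thesis
  proof (cases "?X = {}")
    case False
    then have "Sup ?X \<le> n - 1" using X by (intro cSup_least) auto
    then show ?thesis using assms(1) unfolding E_max_def by linarith
  qed (simp add: E_max_def Sup_nat_def assms(1))
qed

text \<open>A supremum of naturals dominates the members only of a bounded set. The inequality for
  \<open>n\<close> supplies a bound uniform over all bases of order \<open>h\<close>.\<close>

lemma le_E_max:
  assumes A: "basis_of_order A h" and "(n * k + 1) ^ (h - 1) < fact (n + 1)"
    and \<E>: "\<E> \<subseteq> {E. essential_subset A E \<and> card E = k}"
  shows "card \<E> \<le> E_max h k"
proof -
  let ?X = "{card {E. essential_subset A E \<and> card E = k} | A. basis_of_order A h}"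
  let ?T = "{E. essential_subset A E \<and> card E = k}"
  have "bdd_above ?X"
    using card_essential_subsets_less(2)[OF _ assms(2)] by (intro bdd_aboveI[of _ n]) fastforce
  then have le: "card ?T \<le> E_max h k"
    unfolding E_max_def using A by (intro cSup_upper) auto
  have "card \<E> \<le> card ?T"
    by (rule card_mono[OF card_essential_subsets_less(1)[OF A assms(2)] \<E>])
  then show ?thesis using le by (rule order_trans)
qed

subsection \<open>Chebyshev's lower bound\<close>

text \<open>Leibniz's harmonic triangle: the numbers \<open>L n k = k * (n choose k)\<close> satisfy
  \<open>1 / L n (k + 1) = 1 / L (n - 1) k - 1 / L n k\<close>.\<close>
lemma mult_binomial_dvd:
  fixes M :: nat
  assumes "M > 0" "\<And>j. 1 \<le> j \<Longrightarrow> j \<le> N \<Longrightarrow> j dvd M" "1 \<le> k" "k \<le> n" "n \<le> N"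
  shows "k * (n choose k) dvd M"
  using assms(3,4,5)
proof (induction k arbitrary: n rule: nat_induct_at_least)
  case base
  then show ?case using assms(2)[of n] by simp
next
  case (Suc k)
  obtain m where m: "n = Suc m" "k \<le> m" using Suc.prems by (cases n) auto
  obtain u where u: "M = k * (m choose k) * u"
    using Suc.IH[of m] Suc.prems m by auto
  obtain v where v: "M = k * (n choose k) * v"
    using Suc.IH[of n] Suc.prems m by auto
  have pos: "(n choose k) > 0" "(m choose k) > 0" "k > 0"
    using Suc.hyps m by auto
  have uv: "(m choose k) * u = (n choose k) * v" using u v pos by simp
  have ab: "(n choose k) * (n - k) = n * (m choose k)"
    using binomial_absorb_comp[of n k] m by (simp add: mult.commute)
  have "(n choose k) * ((n - k) * u) = (n choose k) * (n * v)"
    using uv ab by (metis mult.assoc mult.commute)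
  then have e: "(n - k) * u = n * v" using pos by simp
  have sk: "Suc k * (n choose Suc k) = n * (m choose k)"
    using m(1) Suc_times_binomial_eq[of m k] by (simp add: mult.commute)
  \<comment> \<open>\<open>u\<close> and \<open>v\<close> are the quotients of \<open>M\<close> by
    the entries at \<open>(m, k)\<close> and \<open>(n, k)\<close>; the identity of the triangle
    makes \<open>u - v\<close> the quotient by the entry at \<open>(n, k + 1)\<close>.\<close>
  have "int n * int v = (int n - int k) * int u"
    using e m by (metis of_nat_diff of_nat_mult Suc_leD Suc.prems(1))
  then have "int k * int u = int n * (int u - int v)"
    by (simp add: algebra_simps)
  moreover have "int M = int (m choose k) * (int k * int u)"
    using u by simp
  ultimately have "int M = int (n * (m choose k)) * (int u - int v)"
    by (simp only: of_nat_mult ac_simps)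
  then have "int (Suc k * (n choose Suc k)) dvd int M"
    unfolding sk by (metis dvd_triv_left)
  then show ?case by (simp only: int_dvd_int_iff)
qed

text \<open>The least common multiple \<open>M\<close> of \<open>1, ..., n\<close> is a product of
  prime powers at most \<open>n\<close>, one for each prime up to \<open>n\<close>. It is also a
  multiple of the \<open>n\<close> numbers \<open>k * (n choose k)\<close>, whose average is
  \<open>2 ^ (n - 1)\<close>.\<close>

lemma power_prime_count_ge:
  assumes "n > 0"
  shows "2 ^ (n - 1) \<le> n ^ card {p. prime p \<and> p \<le> n}"
proof -
  let ?P = "{p. prime p \<and> p \<le> n}"
  have fin: "finite ?P" by (rule finite_subset[of _ "{..n}"]) auto
  define e where "e p = (GREATEST e. p ^ e \<le> n)" for p :: nat
  have bound: "a \<le> n" if "p \<ge> 2" "p ^ a \<le> n" for a p :: nat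
  proof -
    have "a < 2 ^ a" by simp
    also have "\<dots> \<le> p ^ a" using that by (intro power_mono) auto
    finally show ?thesis using that by simp
  qed
  have e1: "p ^ e p \<le> n" if "p \<ge> 2" for p
    unfolding e_def using assms that bound[OF that]
    by (intro GreatestI_nat[where P = "\<lambda>e. p ^ e \<le> n" and k = 0 and b = n]) auto
  have e2: "a \<le> e p" if "p \<ge> 2" "p ^ a \<le> n" for a p
    unfolding e_def using that bound[OF that(1)] by (intro Greatest_le_nat[where b = n]) auto
  define M where "M = (\<Prod>p\<in>?P. p ^ e p)"
  have M0: "M > 0" unfolding M_def by (intro prod_pos) (auto simp: prime_gt_0_nat)
  have dvd: "j dvd M" if j: "1 \<le> j" "j \<le> n" for j
  proof (rule multiplicity_le_imp_dvd)
    show "j \<noteq> 0" using j by simp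
    fix p :: nat assume p: "prime p"
    have p2: "p \<ge> 2" using p by (rule prime_ge_2_nat)
    have "p ^ multiplicity p j dvd j" by (rule multiplicity_dvd)
    then have le: "p ^ multiplicity p j \<le> n" using j dvd_imp_le[of _ j] by fastforce
    show "multiplicity p j \<le> multiplicity p M"
    proof (cases "multiplicity p j = 0")
      case False
      then have "p ^ 1 \<le> p ^ multiplicity p j" using p2 by (intro power_increasing) auto
      then have "p \<in> ?P" using le p by simp
      then have "p ^ e p dvd M"
        unfolding M_def using dvd_prodI[OF fin, of p "\<lambda>p. p ^ e p"] by simp
      moreover have "p ^ multiplicity p j dvd p ^ e p"
        using e2[OF p2 le] by (rule le_imp_power_dvd)
      ultimately show ?thesis
        using M0 p p2 by (intro multiplicity_geI) (auto intro: dvd_trans)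
    qed simp
  qed
  have "n * 2 ^ (n - 1) = (\<Sum>k\<le>n. k * (n choose k))"
    using choose_linear_sum[of n] by simp
  also have "\<dots> = (\<Sum>k\<in>{1..n}. k * (n choose k))"
    by (intro sum.mono_neutral_right) auto
  also have "\<dots> \<le> (\<Sum>k\<in>{1..n}. M)"
    using mult_binomial_dvd[OF M0 dvd] M0 by (intro sum_mono dvd_imp_le) auto
  finally have "2 ^ (n - 1) \<le> M" using assms by simp
  also have "M \<le> (\<Prod>p\<in>?P. n)"
    unfolding M_def using e1 prime_ge_2_nat by (intro prod_mono) auto
  also have "\<dots> = n ^ card ?P" by simp
  finally show ?thesis .
qed

subsection \<open>Lower bound\<close>

text \<open>The class of \<open>x\<close> splits into one contribution per block; \<open>\<Prod>S / \<Prod>(block b)\<close> is a unit modulo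
  the primes of block \<open>b\<close> and vanishes modulo all others.\<close>
lemma block_residue_representation:
  fixes S :: "nat set" and bl :: "nat \<Rightarrow> nat"
  assumes S: "finite S" "\<And>p. p \<in> S \<Longrightarrow> prime p" and bl: "\<And>p. p \<in> S \<Longrightarrow> bl p < m"
  defines "Q \<equiv> \<lambda>b. \<Prod>{p \<in> S. bl p \<noteq> b}" and "R \<equiv> \<lambda>b. \<Prod>{p \<in> S. bl p = b}"
  shows "\<exists>y. (\<forall>b. y b < R b) \<and> [(\<Sum>b<m. Q b * y b) = x] (mod \<Prod>S)"
proof -
  have Rpos: "R b > 0" for b
    unfolding R_def using S(2) by (intro prod_pos) (auto simp: prime_gt_0_nat)
  have "\<exists>y<R b. [Q b * y = x] (mod R b)" for b
  proof -
    have "coprime (Q b) (R b)"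
      unfolding Q_def R_def using S(2)
      by (intro prod_coprime_left prod_coprime_right) (auto intro!: primes_coprime)
    then obtain u where u: "[Q b * u = 1] (mod R b)"
      using cong_solve_coprime_nat by auto
    have "[Q b * (u * x mod R b) = Q b * (u * x)] (mod R b)"
      by (intro cong_mult cong_refl) simp
    also have "Q b * (u * x) = Q b * u * x" by simp
    also have "[Q b * u * x = 1 * x] (mod R b)"
      by (intro cong_mult cong_refl u)
    finally show ?thesis using Rpos by (intro exI[of _ "u * x mod R b"]) simp
  qed
  then obtain y where y: "\<And>b. y b < R b" "\<And>b. [Q b * y b = x] (mod R b)" by metis
  have "[(\<Sum>b<m. Q b * y b) = x] (mod \<Prod>S)"
  proof (rule cong_prod_distinct_primes[OF S])
    fix p assume p: "p \<in> S"
    have "p dvd Q b * y b" if "b \<noteq> bl p" for b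
      unfolding Q_def using p that S(1) dvd_prodI[of "{q \<in> S. bl q \<noteq> b}" p "\<lambda>q. q"] by auto
    then have "p dvd (\<Sum>b\<in>{..<m} - {bl p}. Q b * y b)"
      by (intro dvd_sum) auto
    then have "[(\<Sum>b\<in>{..<m} - {bl p}. Q b * y b) = 0] (mod p)"
      by (simp add: cong_0_iff)
    moreover have "p dvd R (bl p)"
      unfolding R_def using p S(1) dvd_prodI[of "{q \<in> S. bl q = bl p}" p "\<lambda>q. q"] by auto
    then have "[Q (bl p) * y (bl p) = x] (mod p)"
      using y(2) cong_dvd_modulus_nat by blast
    ultimately have "[Q (bl p) * y (bl p) + (\<Sum>b\<in>{..<m} - {bl p}. Q b * y b) = x + 0] (mod p)"
      by (rule cong_add[rotated])
    then show "[(\<Sum>b<m. Q b * y b) = x] (mod p)"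
      using bl[OF p] by (simp add: sum.remove)
  qed
  then show ?thesis using y(1) by blast
qed

text \<open>The order is \<open>m + 1\<close> because each block may need a summand of its own and a
  further multiple of \<open>P\<close> supplies the size. The bound on the block products leaves
  room to pad every essential set to exactly \<open>k\<close> elements.\<close>

lemma basis_with_essential_primes:
  fixes S :: "nat set" and bl :: "nat \<Rightarrow> nat"
  assumes S: "finite S" "\<And>p. p \<in> S \<Longrightarrow> prime p" and bl: "bl ` S = {..<m}"
    and k: "\<And>b. b < m \<Longrightarrow> \<Prod>{p \<in> S. bl p = b} \<le> k" and m: "m > 0"
  shows "\<exists>A. basis_of_order A (m + 1) \<and>
           (\<exists>\<E> \<subseteq> {E. essential_subset A E \<and> card E = k}. card \<E> = card S)"
proof -
  define P where "P = \<Prod>S"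
  define Q where "Q b = \<Prod>{p \<in> S. bl p \<noteq> b}" for b
  define Rb where "Rb b = \<Prod>{p \<in> S. bl p = b}" for b
  have P0: "P > 0" unfolding P_def using S by (intro prod_pos) (auto simp: prime_gt_0_nat)
  have Q0: "Q b > 0" for b
    unfolding Q_def using S by (intro prod_pos) (auto simp: prime_gt_0_nat)
  have PQR: "P = Q b * Rb b" for b
    unfolding P_def Q_def Rb_def using S(1)
    by (subst prod.union_disjoint[symmetric]) (auto intro!: prod.cong)
  have pQ: "p dvd Q b" if "p \<in> S" "bl p \<noteq> b" for p b
    unfolding Q_def using that S(1) dvd_prodI[of "{q \<in> S. bl q \<noteq> b}" p "\<lambda>q. q"] by auto
  have pP: "p dvd P" if "p \<in> S" for p
    unfolding P_def using that S(1) dvd_prodI[of S p "\<lambda>q. q"] by auto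
  define D where "D p = \<Prod>(S - {p})" for p
  have PD: "P = p * D p" if "p \<in> S" for p
    unfolding P_def D_def using that S(1) by (simp add: prod.remove)
  have pD: "q dvd D p" if "q \<in> S" "q \<noteq> p" for p q
    unfolding D_def using that S(1) dvd_prodI[of "S - {p}" q "\<lambda>q. q"] by auto
  have npD: "\<not> p dvd D p" if "p \<in> S" for p
  proof -
    have "coprime p (D p)"
      unfolding D_def using that S by (intro prod_coprime_right) (auto intro!: primes_coprime)
    then show ?thesis using S(2)[OF that] by (metis coprime_absorb_left not_prime_unit)
  qed
  have D0: "D p > 0" for p
    unfolding D_def using S by (intro prod_pos) (auto simp: prime_gt_0_nat)

  \<comment> \<open>\<open>R b\<close> represents every nonzero class supported on block \<open>b\<close>, and \<open>X p\<close> pads with integers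
    supported on \<open>p\<close> alone until exactly \<open>k\<close> elements are prime to \<open>p\<close>.\<close>
  define R where "R b = (\<lambda>y. Q b * y) ` {1..<Rb b}" for b
  define N where "N p = k - card {x \<in> R (bl p). \<not> p dvd x}" for p
  define X where "X p = (\<lambda>c. D p + P * c) ` {1..N p}" for p
  define A where "A = {P * c | c. c \<ge> 1} \<union> (\<Union>b<m. R b) \<union> (\<Union>p\<in>S. X p)"
  define Ex where "Ex p = {a \<in> A. \<not> p dvd a}" for p

  have finR: "finite (R b)" for b unfolding R_def by simp
  have finX: "finite (X p)" for p unfolding X_def by simp
  \<comment> \<open>Elements of the \<open>R b\<close> lie below \<open>P\<close> and those of the
    \<open>X p\<close> do not, so the two parts of \<open>Ex p\<close> are disjoint and can be
    counted separately.\<close>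
  have R_lt: "x < P" if "x \<in> R b" for x b
    using that Q0[of b] unfolding PQR[of b] R_def by auto
  have X_ge: "x \<ge> P" if "x \<in> X p" for x p
  proof -
    obtain c where c: "x = D p + P * c" "c \<in> {1..N p}"
      using \<open>x \<in> X p\<close> unfolding X_def by blast
    then have "P * 1 \<le> P * c" by (intro mult_le_mono2) simp
    then show ?thesis unfolding c(1) by linarith
  qed
  have R_dvd: "p dvd x" if "x \<in> R b" "p \<in> S" "bl p \<noteq> b" for x b p
    using that pQ by (auto simp: R_def)
  have X_dvd: "q dvd x \<longleftrightarrow> q \<noteq> p" if "x \<in> X p" "q \<in> S" "p \<in> S" for x p q
  proof -
    obtain c where x: "x = D p + P * c" using \<open>x \<in> X p\<close> by (auto simp: X_def)
    have "q dvd x \<longleftrightarrow> q dvd D p"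
      unfolding x using pP[OF that(2)] by (simp add: dvd_add_left_iff)
    then show ?thesis using pD npD that by blast
  qed
  have Ex_eq: "Ex p = {x \<in> R (bl p). \<not> p dvd x} \<union> X p" if p: "p \<in> S" for p
    using R_dvd X_dvd p bl pP[OF p] by (auto simp: Ex_def A_def)
  have card_Ex: "card (Ex p) = k" "finite (Ex p)" if p: "p \<in> S" for p
  proof -
    have b: "bl p < m" using bl p by blast
    \<comment> \<open>The block product is at most \<open>k\<close>, so the truncated subtraction in
      \<open>N p\<close> loses nothing.\<close>
    have "card {x \<in> R (bl p). \<not> p dvd x} \<le> card (R (bl p))"
      using finR by (intro card_mono) auto
    also have "\<dots> \<le> card {1..<Rb (bl p)}" unfolding R_def by (intro card_image_le) simp
    also have "\<dots> \<le> k" using k[OF b] by (simp add: Rb_def)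
    finally have le: "card {x \<in> R (bl p). \<not> p dvd x} \<le> k" .
    have "card (X p) = N p"
      unfolding X_def using P0 by (subst card_image) (auto intro!: inj_onI)
    moreover have "{x \<in> R (bl p). \<not> p dvd x} \<inter> X p = {}"
      using R_lt X_ge by (auto dest!: leD)
    ultimately show "card (Ex p) = k"
      unfolding Ex_eq[OF p] using finR finX le by (subst card_Un_disjoint) (auto simp: N_def)
    show "finite (Ex p)" unfolding Ex_eq[OF p] using finR finX by simp
  qed
  have PA: "P * c \<in> A" if "c \<ge> 1" for c using that by (auto simp: A_def)
  have A0: "0 \<notin> A"
    using P0 Q0 D0 by (auto simp: A_def R_def X_def) (metis less_irrefl)
  have RA: "Q b * y \<in> A" if "b < m" "1 \<le> y" "y < Rb b" for b y
  proof -
    have "Q b * y \<in> R b" unfolding R_def using that by (intro imageI) simp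
    then show ?thesis using that(1) unfolding A_def by blast
  qed

  have cof: "cofin_pos (sumset (m + 1) A)"
    unfolding cofin_pos_iff
  proof (intro exI allI impI)
    fix n assume n: "n > m * P"
    obtain y where y: "\<And>b. y b < Rb b" "[(\<Sum>b<m. Q b * y b) = n] (mod P)"
      using block_residue_representation[OF S, of bl m n] bl
      unfolding Q_def Rb_def P_def by blast
    \<comment> \<open>A vanishing contribution is replaced by \<open>P\<close>, since 0 is not in
      \<open>A\<close>; the residue is unchanged and there are exactly \<open>m\<close>
      summands.\<close>
    define z where "z b = (if y b = 0 then P else Q b * y b)" for b
    have zA: "z b \<in> A" if "b < m" for b
      using RA[OF that, of "y b"] y(1)[of b] PA[of 1] by (auto simp: z_def)
    have zP: "z b \<le> P" for b
      using y(1)[of b] unfolding z_def by (auto simp: PQR[of b])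
    have "(\<Sum>b<m. z b) \<le> m * P"
      using sum_bounded_above[of "{..<m}" z P] zP by simp
    have "[(\<Sum>b<m. z b) = (\<Sum>b<m. Q b * y b)] (mod P)"
      by (intro cong_sum) (auto simp: z_def cong_0_iff)
    then have c: "[(\<Sum>b<m. z b) = n] (mod P)" using y(2) cong_trans by blast
    have "(\<Sum>b<m. z b) < n" using \<open>(\<Sum>b<m. z b) \<le> m * P\<close> n by simp
    then have "P dvd n - (\<Sum>b<m. z b)"
      using c by (simp add: cong_altdef_nat cong_sym_eq)
    then obtain d where d: "n - (\<Sum>b<m. z b) = P * d" by blast
    have "d \<noteq> 0" using d \<open>(\<Sum>b<m. z b) < n\<close> by (metis mult_0_right not_less zero_less_diff le_refl)
    then have "P * d \<in> A" by (intro PA) simp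
    moreover have "(\<Sum>b<m. z b) \<in> sumset m A"
      using zA unfolding sumset_def by blast
    ultimately have "(\<Sum>b<m. z b) + P * d \<in> sumset (Suc m) A"
      unfolding sumset_Suc by blast
    also have "(\<Sum>b<m. z b) + P * d = n"
      using d \<open>(\<Sum>b<m. z b) < n\<close> by linarith
    finally show "n \<in> sumset (m + 1) A" by simp
  qed

  \<comment> \<open>One test prime per block: an element of \<open>A\<close> escapes divisibility by
    \<open>q b\<close> for at most one \<open>b\<close>, so a sum of \<open>j\<close> elements does
    so for at most \<open>j\<close> blocks.\<close>
  have "\<forall>b<m. \<exists>p\<in>S. bl p = b" using bl by (metis imageE lessThan_iff)
  then obtain q where q: "\<And>b. b < m \<Longrightarrow> q b \<in> S \<and> bl (q b) = b" by metis
  have one_block: "card {b. b < m \<and> \<not> q b dvd a} \<le> 1" if "a \<in> A" for a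
  proof -
    have "\<exists>b0. \<forall>b<m. b \<noteq> b0 \<longrightarrow> q b dvd a"
    proof -
      consider c where "a = P * c" | b where "a \<in> R b" | p where "p \<in> S" "a \<in> X p"
        using \<open>a \<in> A\<close> by (auto simp: A_def)
      then show ?thesis
      proof cases
        case 1
        then show ?thesis using pP q by (metis dvd_mult2)
      next
        case 2
        then show ?thesis using R_dvd q by metis
      next
        case 3
        then show ?thesis using X_dvd q by metis
      qed
    qed
    then obtain b0 where "\<forall>b<m. b \<noteq> b0 \<longrightarrow> q b dvd a" by blast
    then have "{b. b < m \<and> \<not> q b dvd a} \<subseteq> {b0}" by blast
    then show ?thesis using card_mono[of "{b0}"] by fastforce
  qed
  have blocks: "card {b. b < m \<and> \<not> q b dvd x} \<le> j" if "x \<in> sumset j A" for j x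
    using that
  proof (induction j arbitrary: x)
    case (Suc j)
    then obtain y a where ya: "x = y + a" "y \<in> sumset j A" "a \<in> A" by (auto simp: sumset_Suc)
    have "{b. b < m \<and> \<not> q b dvd x} \<subseteq> {b. b < m \<and> \<not> q b dvd y} \<union> {b. b < m \<and> \<not> q b dvd a}"
      using ya(1) by auto
    then have "card {b. b < m \<and> \<not> q b dvd x}
        \<le> card ({b. b < m \<and> \<not> q b dvd y} \<union> {b. b < m \<and> \<not> q b dvd a})"
      by (intro card_mono) auto
    also have "\<dots> \<le> card {b. b < m \<and> \<not> q b dvd y} + card {b. b < m \<and> \<not> q b dvd a}"
      by (rule card_Un_le)
    also have "\<dots> \<le> j + 1" using Suc.IH[OF ya(2)] one_block[OF ya(3)] by (rule add_mono)
    finally show ?case by simp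
  qed simp

  have not_cof: "\<not> cofin_pos (sumset m A)"
  proof
    assume "cofin_pos (sumset m A)"
    then obtain N0 where N0: "\<And>n. n > N0 \<Longrightarrow> n \<in> sumset m A"
      by (auto simp: cofin_pos_iff)
    have "finite ((\<Union>b<m. R b) \<union> (\<Union>p\<in>S. X p))" using S finR finX by simp
    then obtain M where M: "\<forall>a\<in>(\<Union>b<m. R b) \<union> (\<Union>p\<in>S. X p). a \<le> M"
      by (meson finite_nat_set_iff_bounded_le)
    \<comment> \<open>\<open>n\<close> is 1 modulo \<open>P\<close>, so no test prime divides it.
      Its large summand is a multiple of \<open>P\<close>, and the other \<open>m - 1\<close>
      summands cannot account for all \<open>m\<close> blocks.\<close>
    define n where "n = 1 + P * (N0 + m * M + 1)"
    have "1 * (N0 + m * M + 1) \<le> P * (N0 + m * M + 1)"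
      using P0 by (intro mult_le_mono1) simp
    then have "N0 + m * M + 1 \<le> n" unfolding n_def mult_1 by (rule trans_le_add2)
    then have n: "n > N0" "n > Suc (m - 1) * M" using m by simp_all
    have "n \<in> sumset (Suc (m - 1)) A" using N0[OF n(1)] m by simp
    then obtain a y where ay: "a \<in> A" "y \<in> sumset (m - 1) A" "a > M" "n = a + y"
      using sumset_large_summand[OF _ n(2)] by blast
    have "a \<in> {P * c | c. c \<ge> 1}" using ay(1,3) M unfolding A_def by (meson UnE UnI1 UnI2 leD)
    then have Pa: "P dvd a" by auto
    have "\<not> q b dvd y" if b: "b < m" for b
    proof
      assume "q b dvd y"
      moreover have "q b dvd P" using q[OF b] pP by blast
      ultimately have "q b dvd 1"
        using Pa ay(4) unfolding n_def by (metis dvd_add dvd_add_left_iff dvd_mult2 dvd_trans)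
      then show False using S(2) q[OF b] not_prime_1 by (metis nat_dvd_1_iff_1)
    qed
    then have "{b. b < m \<and> \<not> q b dvd y} = {..<m}" by auto
    then show False using blocks[OF ay(2)] m by simp
  qed
  have order: "basis_of_order A (m + 1)"
    using A0 cof not_cof by (simp add: basis_of_order_def pos_nat_set_def)
  then have basis: "is_basis A" unfolding is_basis_def by blast

  \<comment> \<open>The witness is \<open>D p\<close>: it lies in \<open>R (bl p)\<close> as
    \<open>Q (bl p)\<close> times the cofactor of \<open>p\<close> in its block product.\<close>
  have DA: "\<exists>x\<in>A. \<forall>q\<in>S. q dvd x \<longleftrightarrow> q \<noteq> p" if p: "p \<in> S" for p
  proof -
    have b: "bl p < m" using bl p by blast
    have "p dvd Rb (bl p)"
      unfolding Rb_def using p S(1) dvd_prodI[of "{q \<in> S. bl q = bl p}" p "\<lambda>q. q"] by auto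
    then obtain y where y: "Rb (bl p) = p * y" by blast
    have "Rb (bl p) > 0" using P0 unfolding PQR[of "bl p"] by simp
    then have "y \<ge> 1" "y < Rb (bl p)" using y prime_gt_1_nat[OF S(2)[OF p]] by auto
    then have "Q (bl p) * y \<in> A" by (rule RA[OF b])
    moreover have "p * (Q (bl p) * y) = p * D p"
      using PQR[of "bl p"] PD[OF p] unfolding y by (metis mult.left_commute)
    then have "Q (bl p) * y = D p"
      using prime_gt_0_nat[OF S(2)[OF p]] by (simp only: mult_cancel1) simp
    ultimately show ?thesis using pD npD p by (intro bexI[of _ "D p"]) auto
  qed

  have ess: "essential_subset A (Ex p)" if p: "p \<in> S" for p
    unfolding essential_subset_def
  proof (intro conjI allI impI)
    show "is_basis A" by (rule basis)
    show "finite (Ex p)" by (rule card_Ex(2)[OF p])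
    show "Ex p \<subseteq> A" by (auto simp: Ex_def)
    have "\<forall>a\<in>A - Ex p. [a = 0] (mod p)" by (auto simp: Ex_def cong_0_iff)
    then show "\<not> is_basis (A - Ex p)"
      using basis_not_single_class[of "A - Ex p" p 0] prime_ge_2_nat[OF S(2)[OF p]] by blast
  next
    fix E' assume E': "E' \<subset> Ex p"
    show "is_basis (A - E')"
    proof (rule basis_remove_finite[OF basis])
      show "finite E'" using E' card_Ex(2)[OF p] finite_subset by blast
      fix l r :: nat assume l: "prime l"
      show "\<exists>b\<in>A - E'. [b \<noteq> r] (mod l)"
      proof (rule ccontr)
        assume "\<not> ?thesis"
        then have *: "[b = r] (mod l)" if "b \<in> A - E'" for b using that by blast
        \<comment> \<open>The multiples \<open>P\<close> and \<open>2 * P\<close> survive the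
          removal; sharing a class modulo \<open>l\<close>, they force \<open>l\<close> to divide
          \<open>P\<close>, so \<open>l\<close> is in \<open>S\<close> and the class is 0.\<close>
        have PE: "P * c \<in> A - E'" if "c \<ge> 1" for c
          using E' PA[OF that] pP[OF p] by (auto simp: Ex_def)
        have "[P * 2 = P * 1] (mod l)"
          using cong_trans[OF *[OF PE[of 2]] cong_sym[OF *[OF PE[of 1]]]] by simp
        then have "l dvd P * 2 - P * 1" using cong_altdef_nat[of "P * 1" "P * 2" l] by simp
        then have lP: "l dvd P" by simp
        then have "l \<in> S"
          using l S unfolding P_def by (metis prime_dvd_prod_iff primes_dvd_imp_eq)
        have r0: "[r = 0] (mod l)"
          using *[OF PE[of 1]] lP by (metis cong_0_iff cong_sym cong_trans le_refl mult.right_neutral)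
        have dvd: "l dvd b" if "b \<in> A - E'" for b
          using *[OF that] r0 cong_trans cong_0_iff by blast
        \<comment> \<open>For \<open>l = p\<close>, some element of \<open>Ex p\<close> outside
          \<open>E'\<close> survives. For any other \<open>l\<close>, the element from
          \<open>DA\<close> for \<open>l\<close> survives, because \<open>p\<close> divides it and
          it is therefore not in \<open>Ex p\<close>.\<close>
        show False
        proof (cases "l = p")
          case True
          then show False using E' dvd by (auto simp: Ex_def)
        next
          case False
          obtain x where x: "x \<in> A" "\<forall>q\<in>S. q dvd x \<longleftrightarrow> q \<noteq> l" using DA[OF \<open>l \<in> S\<close>] by blast
          then have "x \<in> A - E'" using E' p False by (auto simp: Ex_def)
          then show False using dvd x(2) \<open>l \<in> S\<close> by blast
        qed
      qed
    qed
  qed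
  have "inj_on Ex S"
  proof (rule inj_onI)
    fix p p' assume p: "p \<in> S" "p' \<in> S" "Ex p = Ex p'"
    obtain x where x: "x \<in> A" "\<forall>q\<in>S. q dvd x \<longleftrightarrow> q \<noteq> p" using DA[OF p(1)] by blast
    then have "x \<in> Ex p'" using p unfolding p(3)[symmetric] by (auto simp: Ex_def)
    then show "p = p'" using x(2) p(2) by (auto simp: Ex_def)
  qed
  then have "card (Ex ` S) = card S" by (rule card_image)
  moreover have "Ex ` S \<subseteq> {E. essential_subset A E \<and> card E = k}"
    using ess card_Ex(1) by blast
  ultimately show ?thesis using order by blast
qed

text \<open>Take \<open>m * t\<close> primes up to \<open>Q\<close> and cut an enumeration of them
  into \<open>m\<close> runs of length \<open>t\<close>; each block product is then at most
  \<open>Q ^ t\<close>. The inequality for \<open>n\<close> keeps the supremum bounded.\<close>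

lemma E_max_ge:
  assumes m: "m > 0" and t: "t > 0" and Qt: "Q ^ t \<le> k"
    and primes: "m * t \<le> card {p. prime p \<and> p \<le> Q}"
    and n: "(n * k + 1) ^ m < fact (n + 1)"
  shows "m * t \<le> E_max (m + 1) k"
proof -
  obtain S where S: "S \<subseteq> {p. prime p \<and> p \<le> Q}" "card S = m * t" "finite S"
    using obtain_subset_with_card_n[OF primes] by blast
  obtain g where g: "bij_betw g S {0..<m * t}"
    using ex_bij_betw_finite_nat[OF S(3)] S(2) by auto
  define bl where "bl p = g p div t" for p
  have "bl ` S = (\<lambda>i. i div t) ` g ` S" unfolding bl_def by (simp add: image_image)
  also have "g ` S = {0..<m * t}" using g by (simp add: bij_betw_def)
  also have "(\<lambda>i. i div t) ` {0..<m * t} = {..<m}"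
  proof (intro equalityI subsetI)
    fix b assume "b \<in> {..<m}"
    then have "b * t \<in> {0..<m * t}" "b = (b * t) div t" using t by auto
    then show "b \<in> (\<lambda>i. i div t) ` {0..<m * t}" by blast
  qed (auto simp: less_mult_imp_div_less)
  finally have bl: "bl ` S = {..<m}" .
  have block: "\<Prod>{p \<in> S. bl p = b} \<le> k" for b
  proof -
    let ?B = "{p \<in> S. bl p = b}"
    have "card ?B = card (g ` ?B)"
      using g by (intro card_image[symmetric]) (auto simp: bij_betw_def intro: inj_on_subset)
    also have "g ` ?B \<subseteq> {b * t..<b * t + t}"
      using t by (auto simp: bl_def dividend_less_div_times add.commute)
    then have "card (g ` ?B) \<le> card {b * t..<b * t + t}" by (intro card_mono) auto
    finally have cB: "card ?B \<le> t" by simp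
    have "S \<noteq> {}" using S(2) m t by auto
    then obtain p where "prime p" "p \<le> Q" using S(1) by blast
    then have Q: "Q \<ge> 1" using prime_ge_1_nat[of p] by linarith
    have "\<Prod>?B \<le> Q ^ card ?B"
      using S(1) prod_mono[of ?B "\<lambda>p. p" "\<lambda>_. Q"] by fastforce
    also have "\<dots> \<le> Q ^ t" using Q cB by (rule power_increasing[rotated])
    finally show ?thesis using Qt by linarith
  qed
  obtain A \<E> where A: "basis_of_order A (m + 1)"
    and \<E>: "\<E> \<subseteq> {E. essential_subset A E \<and> card E = k}" "card \<E> = card S"
    using basis_with_essential_primes[OF S(3) _ bl block m] S(1) by blast
  show ?thesis
    using le_E_max[OF A _ \<E>(1), of n] n \<E>(2) S(2) by simp
qed

subsection \<open>Asymptotics\<close>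

text \<open>A weak form of Stirling's formula; the inductive step rests on
  \<open>ln (1 + 1 / n) \<le> 1 / n\<close>.\<close>

lemma ln_fact_ge: "n > 0 \<Longrightarrow> real n * (ln (real n) - 1) \<le> ln (fact n)"
proof (induction n rule: nat_induct_non_zero)
  case (Suc n)
  have "ln (real (Suc n)) - ln (real n) = ln (1 + 1 / real n)"
    using Suc.hyps by (subst ln_divide_pos[symmetric]) (auto simp: field_simps)
  also have "\<dots> \<le> 1 / real n" using Suc.hyps by (intro ln_add_one_self_le_self) auto
  finally have "real n * (ln (real (Suc n)) - ln (real n)) \<le> 1"
    using Suc.hyps by (simp add: field_simps)
  then have "real (Suc n) * (ln (real (Suc n)) - 1) \<le> real n * (ln (real n) - 1) + ln (real (Suc n))"
    by (simp add: algebra_simps)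
  also have "\<dots> \<le> ln (fact n) + ln (real (Suc n))" using Suc.IH by simp
  also have "\<dots> = ln (fact (Suc n))"
    by (simp add: ln_mult_pos del: of_nat_Suc)
  finally show ?case .
qed simp

text \<open>For \<open>n\<close> about \<open>c * ln k / ln (ln k)\<close>, the factorial has
  logarithm about \<open>n * ln n\<close>, asymptotic to \<open>c * ln k\<close>, while the power
  has logarithm asymptotic to \<open>m * ln k\<close>; so \<open>c > m\<close> decides.\<close>

lemma eventually_power_less_fact:
  fixes m :: nat and c :: real
  assumes m: "m > 0" and c: "real m < c"
  shows "eventually (\<lambda>k. ((nat \<lfloor>c * (ln (real k) / ln (ln (real k)))\<rfloor> + 1) * k + 1) ^ m
           < (fact (nat \<lfloor>c * (ln (real k) / ln (ln (real k)))\<rfloor> + 1 + 1) :: nat)) at_top"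
proof -
  define x where "x k = c * (ln (real k) / ln (ln (real k)))" for k :: nat
  have "c > 0" "real m > 0" using m c by linarith+
  then have "eventually (\<lambda>k. real m * ln ((x k + 1) * real k + 1) < x k * (ln (x k) - 1)) at_top"
    unfolding x_def using c by real_asymp
  \<comment> \<open>This makes \<open>ln (x k) - 1\<close> nonnegative, so that the product stays
    monotone when \<open>x k\<close> is replaced by the larger \<open>n + 1\<close>.\<close>
  moreover have "eventually (\<lambda>k. ln (x k) \<ge> 1) at_top" "eventually (\<lambda>k. x k > 0) at_top"
    unfolding x_def using \<open>c > 0\<close> by real_asymp+
  ultimately show ?thesis
    using eventually_gt_at_top[of 0]
  proof eventually_elim
    case (elim k)
    define n where "n = nat \<lfloor>x k\<rfloor> + 1"
    have n: "real n \<le> x k + 1" "x k \<le> real n"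
      using elim(3) unfolding n_def by linarith+
    have pos: "real (n * k + 1) > 0" by (simp only: of_nat_0_less_iff)
    have le: "ln (x k) \<le> ln (real (n + 1))" using n elim(3) by simp
    have "real m * ln (real (n * k + 1)) \<le> real m * ln ((x k + 1) * real k + 1)"
    proof (intro mult_left_mono ln_mono pos)
      show "real (n * k + 1) \<le> (x k + 1) * real k + 1"
        using n(1) by (simp add: mult_right_mono)
    qed simp
    also have "\<dots> < x k * (ln (x k) - 1)" by (rule elim(1))
    also have "\<dots> \<le> real (n + 1) * (ln (real (n + 1)) - 1)"
      using n elim(2,3) le by (intro mult_mono) auto
    also have "\<dots> \<le> ln (fact (n + 1))" by (rule ln_fact_ge) simp
    finally have "ln (real (n * k + 1) ^ m) < ln (fact (n + 1))"
      by (simp add: ln_realpow)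
    then have "real (n * k + 1) ^ m < fact (n + 1)"
      using zero_less_power[OF pos] by (subst (asm) ln_less_cancel_iff) (auto simp del: of_nat_add of_nat_mult)
    then have "real ((n * k + 1) ^ m) < real (fact (n + 1))"
      by (simp only: of_nat_power of_nat_fact)
    then show ?case unfolding n_def x_def by (simp only: of_nat_less_iff)
  qed
qed

theorem theorem1p1:
  fixes h :: nat
  assumes "h > 0"
  shows "(\<lambda>k. real (E_max h k)) \<sim>[at_top]
           (\<lambda>k. real (h - 1) * (ln (real k) / ln (ln (real k))))"
proof (cases "h = 1")
  case True
  \<comment> \<open>For \<open>h = 1\<close> the power is 1, which is less than
    \<open>fact 2\<close>; both sides of the equivalence are then identically 0.\<close>
  have "E_max h k = 0" for k
    using E_max_less[of 1 k h] True by (simp add: numeral_2_eq_2)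
  then show ?thesis using True by simp
next
  case False
  define m where "m = h - 1"
  have m: "m > 0" "h = m + 1" using assms False by (simp_all add: m_def)
  define g where "g k = ln (real k) / ln (ln (real k))" for k :: nat
  have g_pos: "eventually (\<lambda>k. g k > 0) at_top" unfolding g_def by real_asymp
  have upper: "eventually (\<lambda>k. real (E_max h k) \<le> c * g k) at_top" if "c > real m" for c
    using eventually_power_less_fact[OF m(1) that] g_pos
  proof eventually_elim
    case (elim k)
    have "E_max h k < nat \<lfloor>c * g k\<rfloor> + 1"
      using elim(1) m by (intro E_max_less) (auto simp: g_def)
    moreover have "c * g k \<ge> 0" using that elim(2) by (intro mult_nonneg_nonneg) auto
    ultimately show ?case by linarith
  qed
  have lower: "eventually (\<lambda>k. real m * (ln (real k) / ln (2 * real m * ln (real k) + 2) - 1)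
      \<le> real (E_max h k)) at_top"
  proof -
    \<comment> \<open>Any constant above \<open>m\<close> would do here, as it serves only to bound
      the supremum in \<open>E_max\<close>.\<close>
    have "real m < real m + 1" by simp
    note ex = eventually_power_less_fact[OF m(1) this]
    have "real m > 0" using m by simp
    then have "eventually (\<lambda>k. ln (real k) / ln (2 * real m * ln (real k) + 2) \<ge> 1) at_top"
      by real_asymp
    moreover have "eventually (\<lambda>k. ln (real k) > 1) at_top" by real_asymp
    ultimately show ?thesis
      using ex eventually_gt_at_top[of 0]
    proof eventually_elim
      case (elim k)
      define L where "L = ln (real k)"
      \<comment> \<open>With this \<open>t\<close>, a product of \<open>t\<close> primes up to
        \<open>Q\<close> is at most \<open>k\<close>. The factor 2 offsets the estimate
        \<open>ln 2 \<ge> 1 / 2\<close> in Chebyshev's bound, so that at least \<open>m * t\<close>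
        primes lie up to \<open>Q\<close>.\<close>
      define Q where "Q = nat \<lceil>2 * real m * L\<rceil> + 1"
      define t where "t = nat \<lfloor>L / ln (real Q)\<rfloor>"
      have L: "L > 1" using elim(2) by (simp add: L_def)
      have "2 * real m * L \<ge> 0" using L by simp
      then have Q: "real Q \<le> 2 * real m * L + 2" "2 * real m * L \<le> real Q - 1"
        unfolding Q_def by linarith+
      have "2 * real m * L > 2 * real m * 1" using L m by (intro mult_strict_left_mono) auto
      then have "real Q > 1" using Q(2) m(1) by linarith
      then have lnQ: "ln (real Q) > 0" "ln (real Q) \<le> ln (2 * real m * L + 2)"
        using Q(1) by simp_all
      then have "L / ln (2 * real m * L + 2) \<le> L / ln (real Q)"
        using L by (intro divide_left_mono) auto
      then have t: "L / ln (2 * real m * L + 2) - 1 \<le> real t" "real t \<le> L / ln (real Q)" "t > 0"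
        using elim(1) unfolding t_def L_def by linarith+
      have tL: "real t * ln (real Q) \<le> L" using t(2) lnQ by (simp add: field_simps)
      have Q0: "Q > 0" using \<open>real Q > 1\<close> by simp
      have "ln (real Q ^ t) \<le> ln (real k)" using tL Q0 by (simp add: ln_realpow L_def)
      then have "real Q ^ t \<le> real k" using Q0 elim(4) by (subst (asm) ln_le_cancel_iff) auto
      then have Qt: "Q ^ t \<le> k" by (metis of_nat_le_iff of_nat_power)
      let ?\<pi> = "card {p. prime p \<and> p \<le> Q}"
      have "real m * real t * ln (real Q) \<le> real m * L"
        using tL by (simp add: mult.assoc mult_left_mono)
      also have "\<dots> \<le> (1 / 2) * (real Q - 1)" using Q(2) by simp
      also have "\<dots> \<le> ln 2 * (real Q - 1)"
      proof (rule mult_right_mono)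
        show "1 / 2 \<le> ln (2 :: real)"
          using ln_le_minus_one[of "1 / 2"] by (simp add: ln_div)
      qed (use \<open>real Q > 1\<close> in simp)
      also have "\<dots> = ln (2 ^ (Q - 1))" using Q0 by (simp add: ln_realpow of_nat_diff mult.commute)
      also have "\<dots> \<le> ln (real Q ^ ?\<pi>)"
      proof -
        have "real (2 ^ (Q - 1)) \<le> real (Q ^ ?\<pi>)"
          using power_prime_count_ge[OF Q0] by (simp only: of_nat_le_iff)
        then show ?thesis using Q0 by (intro ln_mono) auto
      qed
      also have "\<dots> = real ?\<pi> * ln (real Q)" using Q0 by (simp add: ln_realpow)
      finally have "real m * real t \<le> real ?\<pi>" using lnQ(1) by simp
      then have primes: "m * t \<le> ?\<pi>" by (metis of_nat_le_iff of_nat_mult)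
      have "m * t \<le> E_max h k"
        unfolding m(2) by (rule E_max_ge[OF m(1) t(3) Qt primes elim(3)])
      then have "real m * real t \<le> real (E_max h k)" by (metis of_nat_le_iff of_nat_mult)
      then show ?case
        using mult_left_mono[OF t(1), of "real m"] unfolding L_def by linarith
    qed
  qed
  have "((\<lambda>k. real (E_max h k) / (real m * g k)) \<longlongrightarrow> 1) at_top"
  proof (rule order_tendstoI)
    fix a :: real assume "a < 1"
    \<comment> \<open>The lower bound has the right order since \<open>ln (2 * m * ln k + 2)\<close>
      is asymptotic to \<open>ln (ln k)\<close>.\<close>
    have "real m > 0" using m by simp
    then have "((\<lambda>k. (ln (real k) / ln (2 * real m * ln (real k) + 2) - 1) / g k) \<longlongrightarrow> 1) at_top"
      unfolding g_def by real_asymp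
    then have "eventually (\<lambda>k. a < (ln (real k) / ln (2 * real m * ln (real k) + 2) - 1) / g k) at_top"
      using \<open>a < 1\<close> by (rule order_tendstoD)
    then show "eventually (\<lambda>k. a < real (E_max h k) / (real m * g k)) at_top"
      using lower g_pos
    proof eventually_elim
      case (elim k)
      have "a < real m * (ln (real k) / ln (2 * real m * ln (real k) + 2) - 1) / (real m * g k)"
        using elim(1) m by simp
      also have "\<dots> \<le> real (E_max h k) / (real m * g k)"
        using elim m by (intro divide_right_mono) auto
      finally show ?case .
    qed
  next
    fix a :: real assume a: "a > 1"
    \<comment> \<open>The midpoint of \<open>m\<close> and \<open>a * m\<close>: above
      \<open>m\<close> so that \<open>upper\<close> applies, below \<open>a * m\<close> for
      strictness.\<close>
    define c where "c = real m * (1 + a) / 2"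
    have c: "real m < c" "c < a * real m" using a m by (simp_all add: c_def field_simps)
    show "eventually (\<lambda>k. real (E_max h k) / (real m * g k) < a) at_top"
      using upper[OF c(1)] g_pos
    proof eventually_elim
      case (elim k)
      have "real (E_max h k) < (a * real m) * g k"
        using elim c(2) by (meson le_less_trans mult_strict_right_mono)
      then show ?case using elim(2) m by (simp add: field_simps)
    qed
  qed
  then show ?thesis unfolding g_def m_def by (rule asymp_equivI')
qed

end
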